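(* Let $A$ be a triassociative algebra over a field $K$, let $\Theta_t=\sum_{i=0}^N\theta_it^i$, with $\theta_i=(\lambda_i,\rho_i,\mu_i)$, be a deformation of order $N<\infty$ ($N\ge 1$) of $A$, and let $\theta_{N+1}$ be an element of $C^2_{\mathrm{Trias}}(A,A)$. Define the polynomial $\widetilde\Theta_t:=\Theta_t+\theta_{N+1}t^{N+1}$. Then $\widetilde\Theta_t$ is a deformation of order $N+1$ if and only if $\mathrm{Ob}_\Theta=\delta^2\theta_{N+1}$.
   Context: All vector spaces and tensor products are over a fixed field $K$. A triassociative algebra is a vector space $A$ with three bilinear operations $L=\dashv$, $R=\vdash$, $M=\bot$ satisfying, for all $x,y,z$, the following $11$ conditions: (1) $L(L(x,y),z)=L(x,L(y,z))$; (2) $L(L(x,y),z)=L(x,R(y,z))$; (3) $L(R(x,y),z)=R(x,L(y,z))$; (4) $R(L(x,y),z)=R(x,R(y,z))$; (5) $R(R(x,y),z)=R(x,R(y,z))$; (6) $L(L(x,y),z)=L(x,M(y,z))$; (7) $L(M(x,y),z)=M(x,L(y,z))$; (8) $M(L(x,y),z)=M(x,R(y,z))$; (9) $M(R(x,y),z)=R(x,M(y,z))$; (10) $R(M(x,y),z)=R(x,R(y,z))$; (11) $M(M(x,y),z)=M(x,M(y,z))$, where $L(x,y)=x\dashv y$, etc. Trees. $T_n$ ($n\ge0$) is the set of planar rooted trees with $n+1$ leaves in which every internal vertex has at least $2$ incoming edges ($T_0=\{|\}$, no internal vertex); $\psi\in T_n$ has degree $|\psi|=n$; leaves are numbered $0,\dots,n$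 from left to right. The grafting $\psi_0\vee\cdots\vee\psi_k$ is obtained by arranging the trees from left to right and joining their roots to a new lowest internal vertex, connected to a new root; every tree of degree $\ge 1$ is uniquely of this form with $k\ge1$. A leaf is left (resp. right) oriented if it is the leftmost (resp. rightmost) incoming edge of the vertex it is attached to; otherwise it is a middle leaf. $d_i\colon T_{n+1}\to T_n$ deletes the $i$th leaf (suppressing any vertex left with one incoming edge). For $\psi=\psi_0\vee\cdots\vee\psi_k\in T_{n+1}$ and $0\le i\le n+1$ define $\circ_i^\psi\in\{\dashv,\vdash,\bot\}$ by: $\circ_0^\psi$ is $\dashv$ if $|\psi_0|=0$ and $k=1$; $\vdash$ if $|\psi_0|>0$; $\bot$ if $|\psi_0|=0$ and $k>1$. For $1\le i\le n$, $\circ_i^\psi$ is $\dashv$, $\vdash$, or $\bot$ according as the $i$th leaf is left oriented, right oriented, or a middle leaf. $\circ_{n+1}^\psi$ is $\dashv$ if $|\psi_k|>0$; $\vdash$ if $k=1$ and $|\psi_1|=0$; $\bot$ if $k>1$ and $|\psi_k|=0$. Cohomology. $C^n_{\mathrm{Trias}}(A,A)=\mathrm{Hom}_K(K[T_n]\otimes A^{\otimes n},A)$ for $n\ge 0$, with coboundary $\delta^n=\sum_{i=0}^{n+1}(-1)^i\delta_i^n\colon C^n_{\mathrm{Trias}}(A,A)\to C^{n+1}_{\mathrm{Trias}}(A,A)$, where for $\psi\in T_{n+1}$, $a_1,\dots,a_{n+1}\in A$: $(\delta_0^nf)(\psi;a_1,\dots,a_{n+1})=a_1\circ_0^\psi f(d_0\psi;a_2,\dots,a_{n+1})$;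 $(\delta_i^nf)(\psi;a_1,\dots,a_{n+1})=f(d_i\psi;a_1,\dots,a_i\circ_i^\psi a_{i+1},\dots,a_{n+1})$ for $1\le i\le n$; $(\delta_{n+1}^nf)(\psi;a_1,\dots,a_{n+1})=f(d_{n+1}\psi;a_1,\dots,a_n)\circ_{n+1}^\psi a_{n+1}$. A $2$-cochain $\theta\in C^2_{\mathrm{Trias}}(A,A)$ is identified with a triple $(\lambda,\rho,\mu)$ of bilinear operations on $A$ by $\theta(\psi;x,y)=\lambda(x,y)$, $\rho(x,y)$, $\mu(x,y)$ for $\psi=|\vee(|\vee|)$, $(|\vee|)\vee|$, $|\vee|\vee|$ respectively. A deformation of order $N\in\{1,2,\dots\}$ of $A$ is a polynomial $\Theta_t=\sum_{i=0}^N\theta_it^i$ with each $\theta_i=(\lambda_i,\rho_i,\mu_i)\in C^2_{\mathrm{Trias}}(A,A)$ and $\theta_0=(\dashv,\vdash,\bot)$, such that $L_t=\sum\lambda_it^i$, $R_t=\sum\rho_it^i$, $M_t=\sum\mu_it^i$ satisfy conditions (1)-(11) (with $L_t,R_t,M_t$ in place of $L,R,M$, extended linearly) modulo $t^{N+1}$ for all $x,y,z\in A$. Obstruction cochain. Write $Y=|\vee|$, and for bilinear-operation sequences $\alpha,\beta,\gamma,\epsilon\in\{\lambda,\rho,\mu\}$ put $[\alpha\beta;\gamma\epsilon](x,y,z)=\sum_{j=1}^N\big(\alpha_j(\beta_{N+1-j}(x,y),z)-\gamma_j(x,\epsilon_{N+1-j}(y,z))\big)$. Then $\mathrm{Ob}_\Theta\in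 C^3_{\mathrm{Trias}}(A,A)$ is defined by $\mathrm{Ob}_\Theta(\psi;x,y,z)=$ $[\lambda\lambda;\lambda\lambda]$ if $\psi=|\vee(|\vee Y)$; $[\lambda\lambda;\lambda\rho]$ if $\psi=|\vee(Y\vee|)$; $[\lambda\rho;\rho\lambda]$ if $\psi=Y\vee Y$; $[\rho\lambda;\rho\rho]$ if $\psi=(|\vee Y)\vee|$; $[\rho\rho;\rho\rho]$ if $\psi=(Y\vee|)\vee|$; $[\lambda\lambda;\lambda\mu]$ if $\psi=|\vee(|\vee|\vee|)$; $[\lambda\mu;\mu\lambda]$ if $\psi=|\vee|\vee Y$; $[\mu\lambda;\mu\rho]$ if $\psi=|\vee Y\vee|$; $[\mu\rho;\rho\mu]$ if $\psi=Y\vee|\vee|$; $[\rho\mu;\rho\rho]$ if $\psi=(|\vee|\vee|)\vee|$; $[\mu\mu;\mu\mu]$ if $\psi=|\vee|\vee|\vee|$ (each evaluated at $(x,y,z)$; these are all $11$ trees of $T_3$). *)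

theory Defs
  imports
    Main
    "HOL-Library.Function_Algebras"
    "HOL-Computational_Algebra.Polynomial"
begin

definition bilinear_op :: "('k::field \<Rightarrow> 'a::ab_group_add \<Rightarrow> 'a) \<Rightarrow> ('a \<Rightarrow> 'a \<Rightarrow> 'a) \<Rightarrow> bool" where
  "bilinear_op scale f \<longleftrightarrow>
     (\<forall>x. Vector_Spaces.linear scale scale (\<lambda>y. f x y)) \<and>
     (\<forall>y. Vector_Spaces.linear scale scale (\<lambda>x. f x y))"

text \<open>
  The eleven identities at a triple \<open>x, y, z\<close>, stated for an arbitrary relation \<open>eq\<close>: equality
  gives triassociative algebras, congruence modulo a power of \<open>t\<close> gives deformations.
\<close>

definition trias_identities ::
  "('b \<Rightarrow> 'b \<Rightarrow> bool) \<Rightarrow> ('b \<Rightarrow> 'b \<Rightarrow> 'b) \<Rightarrow> ('b \<Rightarrow> 'b \<Rightarrow> 'b) \<Rightarrow> ('b \<Rightarrow> 'b \<Rightarrow> 'b) \<Rightarrow>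
     'b \<Rightarrow> 'b \<Rightarrow> 'b \<Rightarrow> bool" where
  "trias_identities eq L R M x y z \<longleftrightarrow>
     eq (L (L x y) z) (L x (L y z)) \<and>
     eq (L (L x y) z) (L x (R y z)) \<and>
     eq (L (R x y) z) (R x (L y z)) \<and>
     eq (R (L x y) z) (R x (R y z)) \<and>
     eq (R (R x y) z) (R x (R y z)) \<and>
     eq (L (L x y) z) (L x (M y z)) \<and>
     eq (L (M x y) z) (M x (L y z)) \<and>
     eq (M (L x y) z) (M x (R y z)) \<and>
     eq (M (R x y) z) (R x (M y z)) \<and>
     eq (R (M x y) z) (R x (R y z)) \<and>
     eq (M (M x y) z) (M x (M y z))"

locale triassociative_algebra = vector_space scale
  for scale :: "'k::field \<Rightarrow> 'a::ab_group_add \<Rightarrow> 'a" +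
  fixes L R M :: "'a \<Rightarrow> 'a \<Rightarrow> 'a"
  assumes bilinear_L: "bilinear_op scale L"
    and bilinear_R: "bilinear_op scale R"
    and bilinear_M: "bilinear_op scale M"
    and identities: "trias_identities (=) L R M x y z"

text \<open>\<open>Node [\<psi>\<^sub>0, \<dots>, \<psi>\<^sub>k]\<close> is the grafting \<open>\<psi>\<^sub>0 \<or> \<cdots> \<or> \<psi>\<^sub>k\<close>; \<open>Leaf\<close> is the tree without vertices.\<close>

datatype ptree = Leaf | Node "ptree list"

abbreviation cherry :: ptree where
  "cherry \<equiv> Node [Leaf, Leaf]"

fun admissible :: "ptree \<Rightarrow> bool" where
  "admissible Leaf = True"
| "admissible (Node ts) = (2 \<le> length ts \<and> (\<forall>t \<in> set ts. admissible t))"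

fun leaves :: "ptree \<Rightarrow> nat" where
  "leaves Leaf = 1"
| "leaves (Node ts) = sum_list (map leaves ts)"

definition tree_degree :: "ptree \<Rightarrow> nat" where
  "tree_degree \<psi> = leaves \<psi> - 1"

definition trees :: "nat \<Rightarrow> ptree set" where
  "trees n = {\<psi>. admissible \<psi> \<and> leaves \<psi> = n + 1}"

text \<open>\<open>join\<close> suppresses a vertex left with a single incoming edge.\<close>

fun join :: "ptree list \<Rightarrow> ptree" where
  "join [t] = t"
| "join ts = Node ts"

text \<open>
  Deletion of the \<open>i\<close>th leaf, counted from the left starting at \<open>0\<close>, in a tree and in a list of
  sibling subtrees. The value on \<open>Leaf\<close> is irrelevant: only trees of positive degree occur.
\<close>

fun delete_leaf :: "nat \<Rightarrow> ptree \<Rightarrow> ptree"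
  and delete_leaf_list :: "nat \<Rightarrow> ptree list \<Rightarrow> ptree list" where
  "delete_leaf i Leaf = Leaf"
| "delete_leaf i (Node ts) = join (delete_leaf_list i ts)"
| "delete_leaf_list i [] = []"
| "delete_leaf_list i (t # ts) =
     (if i < leaves t then (if t = Leaf then ts else delete_leaf i t # ts)
      else t # delete_leaf_list (i - leaves t) ts)"

datatype opsym = Dashv | Vdash | Perp

text \<open>
  Orientation of the \<open>i\<close>th leaf: \<open>Dashv\<close> for left oriented, \<open>Vdash\<close> for right oriented, \<open>Perp\<close>
  for a middle leaf. The Boolean of the auxiliary function records whether the head of the list
  is the leftmost incoming edge of its vertex.
\<close>

fun leaf_orientation :: "nat \<Rightarrow> ptree \<Rightarrow> opsym"
  and leaf_orientation_list :: "bool \<Rightarrow> nat \<Rightarrow> ptree list \<Rightarrow> opsym" where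
  "leaf_orientation i Leaf = Perp"
| "leaf_orientation i (Node ts) = leaf_orientation_list True i ts"
| "leaf_orientation_list leftmost i [] = Perp"
| "leaf_orientation_list leftmost i (t # ts) =
     (if i < leaves t then
        (if t = Leaf then (if leftmost then Dashv else if ts = [] then Vdash else Perp)
         else leaf_orientation i t)
      else leaf_orientation_list False (i - leaves t) ts)"

text \<open>
  The operation attached to \<open>\<psi> = \<psi>\<^sub>0 \<or> \<cdots> \<or> \<psi>\<^sub>k\<close> and \<open>i\<close>; here \<open>length ts = k + 1\<close>, so
  \<open>length ts = 2\<close> says \<open>k = 1\<close>.
\<close>

fun circ :: "nat \<Rightarrow> ptree \<Rightarrow> opsym" where
  "circ i Leaf = Perp"
| "circ i (Node ts) =
     (if i = 0 then
        (if tree_degree (hd ts) > 0 then Vdash else if length ts = 2 then Dashv else Perp)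
      else if i = tree_degree (Node ts) then
        (if tree_degree (last ts) > 0 then Dashv else if length ts = 2 then Vdash else Perp)
      else leaf_orientation i (Node ts))"

fun interp :: "('a \<Rightarrow> 'a \<Rightarrow> 'a) \<Rightarrow> ('a \<Rightarrow> 'a \<Rightarrow> 'a) \<Rightarrow> ('a \<Rightarrow> 'a \<Rightarrow> 'a) \<Rightarrow> opsym \<Rightarrow> 'a \<Rightarrow> 'a \<Rightarrow> 'a" where
  "interp L R M Dashv = L"
| "interp L R M Vdash = R"
| "interp L R M Perp = M"

text \<open>
  A linear map from \<open>K[T\<^sub>n] \<otimes> A\<^bsup>\<otimes>n\<^esup>\<close> to \<open>A\<close> is given by its values \<open>f \<psi> [a\<^sub>1, \<dots>, a\<^sub>n]\<close> on the
  tensors \<open>\<psi> \<otimes> a\<^sub>1 \<otimes> \<cdots> \<otimes> a\<^sub>n\<close> with \<open>\<psi>\<close> in \<open>T\<^sub>n\<close>, which are subject only to multilinearity in the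
  \<open>a\<^sub>i\<close>. Cochains take the value \<open>0\<close> on all other arguments, so that equality of cochains is
  equality of functions.
\<close>

type_synonym 'a cochain = "ptree \<Rightarrow> 'a list \<Rightarrow> 'a"

definition multilinear_on ::
  "('k::field \<Rightarrow> 'a::ab_group_add \<Rightarrow> 'a) \<Rightarrow> nat \<Rightarrow> ('a list \<Rightarrow> 'a) \<Rightarrow> bool" where
  "multilinear_on scale n g \<longleftrightarrow>
     (\<forall>as i. length as = n \<longrightarrow> i < n \<longrightarrow>
        Vector_Spaces.linear scale scale (\<lambda>x. g (as[i := x])))"

definition cochains :: "('k::field \<Rightarrow> 'a::ab_group_add \<Rightarrow> 'a) \<Rightarrow> nat \<Rightarrow> 'a cochain set" where
  "cochains scale n =
     {f. (\<forall>\<psi> \<in> trees n. multilinear_on scale n (f \<psi>)) \<and>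
         (\<forall>\<psi> as. \<not> (\<psi> \<in> trees n \<and> length as = n) \<longrightarrow> f \<psi> as = 0)}"

text \<open>
  The list \<open>as\<close> contains \<open>a\<^sub>1, \<dots>, a\<^bsub>n+1\<^esub>\<close>, so \<open>a\<^sub>i\<close> is \<open>as ! (i - 1)\<close>.
\<close>

definition coface ::
  "('a \<Rightarrow> 'a \<Rightarrow> 'a) \<Rightarrow> ('a \<Rightarrow> 'a \<Rightarrow> 'a) \<Rightarrow> ('a \<Rightarrow> 'a \<Rightarrow> 'a) \<Rightarrow> nat \<Rightarrow> nat \<Rightarrow> 'a cochain \<Rightarrow> 'a cochain" where
  "coface L R M n i f \<psi> as =
     (let op = interp L R M (circ i \<psi>) in
      if i = 0 then op (hd as) (f (delete_leaf 0 \<psi>) (tl as))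
      else if i = n + 1 then op (f (delete_leaf (n + 1) \<psi>) (butlast as)) (last as)
      else f (delete_leaf i \<psi>) (take (i - 1) as @ [op (as ! (i - 1)) (as ! i)] @ drop (i + 1) as))"

definition coboundary ::
  "('k::field \<Rightarrow> 'a::ab_group_add \<Rightarrow> 'a) \<Rightarrow> ('a \<Rightarrow> 'a \<Rightarrow> 'a) \<Rightarrow> ('a \<Rightarrow> 'a \<Rightarrow> 'a) \<Rightarrow> ('a \<Rightarrow> 'a \<Rightarrow> 'a) \<Rightarrow>
     nat \<Rightarrow> 'a cochain \<Rightarrow> 'a cochain" where
  "coboundary scale L R M n f \<psi> as =
     (if \<psi> \<in> trees (n + 1) \<and> length as = n + 1
      then \<Sum>i = 0..n + 1. scale ((-1) ^ i) (coface L R M n i f \<psi> as)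
      else 0)"

text \<open>
  Via \<open>lam\<close>, \<open>rho\<close>, \<open>mu\<close> a \<open>2\<close>-cochain is identified with a triple of bilinear operations; the
  three trees below are all the elements of \<open>T\<^sub>2\<close>.
\<close>

definition lam :: "'a cochain \<Rightarrow> 'a \<Rightarrow> 'a \<Rightarrow> 'a" where
  "lam \<theta> x y = \<theta> (Node [Leaf, cherry]) [x, y]"

definition rho :: "'a cochain \<Rightarrow> 'a \<Rightarrow> 'a \<Rightarrow> 'a" where
  "rho \<theta> x y = \<theta> (Node [cherry, Leaf]) [x, y]"

definition mu :: "'a cochain \<Rightarrow> 'a \<Rightarrow> 'a \<Rightarrow> 'a" where
  "mu \<theta> x y = \<theta> (Node [Leaf, Leaf, Leaf]) [x, y]"

text \<open>
  A polynomial \<open>F\<close> in \<open>t\<close> whose coefficients are bilinear operations acts on polynomials with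
  coefficients in \<open>A\<close> by extending linearly in \<open>t\<close>.
\<close>

definition extend_op ::
  "('a::ab_group_add \<Rightarrow> 'a \<Rightarrow> 'a) poly \<Rightarrow> 'a poly \<Rightarrow> 'a poly \<Rightarrow> 'a poly" where
  "extend_op F p q =
     (\<Sum>i\<le>degree F. \<Sum>j\<le>degree p. \<Sum>k\<le>degree q.
        monom (coeff F i (coeff p j) (coeff q k)) (i + j + k))"

definition cong_mod_t_power :: "nat \<Rightarrow> 'a::zero poly \<Rightarrow> 'a poly \<Rightarrow> bool" where
  "cong_mod_t_power m p q \<longleftrightarrow> (\<forall>k<m. coeff p k = coeff q k)"

text \<open>
  The bound on the degree is an inequality, since the coefficient of \<open>t\<^sup>N\<close> may vanish.
\<close>

definition deformation ::
  "('k::field \<Rightarrow> 'a::ab_group_add \<Rightarrow> 'a) \<Rightarrow> ('a \<Rightarrow> 'a \<Rightarrow> 'a) \<Rightarrow> ('a \<Rightarrow> 'a \<Rightarrow> 'a) \<Rightarrow> ('a \<Rightarrow> 'a \<Rightarrow> 'a) \<Rightarrow>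
     nat \<Rightarrow> 'a cochain poly \<Rightarrow> bool" where
  "deformation scale L R M N \<Theta> \<longleftrightarrow>
     1 \<le> N \<and> degree \<Theta> \<le> N \<and>
     (\<forall>i\<le>N. coeff \<Theta> i \<in> cochains scale 2) \<and>
     lam (coeff \<Theta> 0) = L \<and> rho (coeff \<Theta> 0) = R \<and> mu (coeff \<Theta> 0) = M \<and>
     (\<forall>x y z. trias_identities (cong_mod_t_power (N + 1))
        (extend_op (map_poly lam \<Theta>)) (extend_op (map_poly rho \<Theta>)) (extend_op (map_poly mu \<Theta>))
        [:x:] [:y:] [:z:])"

definition obstruction_bracket ::
  "nat \<Rightarrow> 'a::ab_group_add cochain poly \<Rightarrow>
     ('a cochain \<Rightarrow> 'a \<Rightarrow> 'a \<Rightarrow> 'a) \<Rightarrow> ('a cochain \<Rightarrow> 'a \<Rightarrow> 'a \<Rightarrow> 'a) \<Rightarrow>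
     ('a cochain \<Rightarrow> 'a \<Rightarrow> 'a \<Rightarrow> 'a) \<Rightarrow> ('a cochain \<Rightarrow> 'a \<Rightarrow> 'a \<Rightarrow> 'a) \<Rightarrow> 'a \<Rightarrow> 'a \<Rightarrow> 'a \<Rightarrow> 'a" where
  "obstruction_bracket N \<Theta> \<alpha> \<beta> \<gamma> \<epsilon> x y z =
     (\<Sum>j = 1..N. \<alpha> (coeff \<Theta> j) (\<beta> (coeff \<Theta> (N + 1 - j)) x y) z -
                  \<gamma> (coeff \<Theta> j) x (\<epsilon> (coeff \<Theta> (N + 1 - j)) y z))"

definition obstruction :: "nat \<Rightarrow> 'a::ab_group_add cochain poly \<Rightarrow> 'a cochain" where
  "obstruction N \<Theta> \<psi> as =
     (case as of [x, y, z] \<Rightarrow>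
        (let br = (\<lambda>\<alpha> \<beta> \<gamma> \<epsilon>. obstruction_bracket N \<Theta> \<alpha> \<beta> \<gamma> \<epsilon> x y z) in
         if \<psi> = Node [Leaf, Node [Leaf, cherry]] then br lam lam lam lam
         else if \<psi> = Node [Leaf, Node [cherry, Leaf]] then br lam lam lam rho
         else if \<psi> = Node [cherry, cherry] then br lam rho rho lam
         else if \<psi> = Node [Node [Leaf, cherry], Leaf] then br rho lam rho rho
         else if \<psi> = Node [Node [cherry, Leaf], Leaf] then br rho rho rho rho
         else if \<psi> = Node [Leaf, Node [Leaf, Leaf, Leaf]] then br lam lam lam mu
         else if \<psi> = Node [Leaf, Leaf, cherry] then br lam mu mu lam
         else if \<psi> = Node [Leaf, cherry, Leaf] then br mu lam mu rho
         else if \<psi> = Node [cherry, Leaf, Leaf] then br mu rho rho mu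
         else if \<psi> = Node [Node [Leaf, Leaf, Leaf], Leaf] then br rho mu rho rho
         else if \<psi> = Node [Leaf, Leaf, Leaf, Leaf] then br mu mu mu mu
         else 0)
      | _ \<Rightarrow> 0)"

end

theory Submission
  imports Defs
begin

text \<open>
  For each of the eleven identities, the coefficient of \<open>t\<^bsup>N+1\<^esup>\<close> in left-hand side minus right-hand
  side is the obstruction bracket plus the four terms that contain \<open>\<theta>\<close>, and these four terms are
  \<open>- \<delta>\<^sup>2 \<theta>\<close> at the tree that indexes the identity. The lower coefficients do not involve \<open>\<theta>\<close>.
\<close>

section \<open>Enumeration of planar trees by degree\<close>

definition forests :: "nat \<Rightarrow> ptree list set" where
  "forests n = {ts. (\<forall>t \<in> set ts. admissible t) \<and> sum_list (map leaves ts) = n}"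

lemma leaves_pos: "admissible t \<Longrightarrow> 0 < leaves t"
proof (induction t)
  case (Node ts)
  then show ?case
    by (cases ts) auto
qed simp

lemma sum_list_leaves_pos:
  "\<forall>t \<in> set ts. admissible t \<Longrightarrow> ts \<noteq> [] \<Longrightarrow> 0 < sum_list (map leaves ts)"
  by (cases ts) (auto simp: leaves_pos)

lemma forests_0: "forests 0 = {[]}"
proof -
  have "ts = []" if "ts \<in> forests 0" for ts
    using that sum_list_leaves_pos[of ts]
    by (metis (mono_tags, lifting) forests_def mem_Collect_eq less_irrefl)
  then show ?thesis
    by (auto simp: forests_def)
qed

text \<open>Splitting off the first tree. \<open>trees\<close> is indexed by degree and
  \<open>forests\<close> by leaves, so a first tree in \<open>trees k\<close> uses up
  \<open>k + 1\<close> of the \<open>Suc n\<close> leaves.\<close>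

lemma forests_Suc: "forests (Suc n) = (\<Union>k\<le>n. \<Union>t\<in>trees k. (#) t ` forests (n - k))"
proof (intro equalityI subsetI)
  fix ts assume ts: "ts \<in> forests (Suc n)"
  then obtain t us where eq: "ts = t # us"
    by (cases ts) (auto simp: forests_def)
  have "0 < leaves t"
    using ts eq leaves_pos by (auto simp: forests_def)
  then have "t \<in> trees (leaves t - 1)" "leaves t - 1 \<le> n" "us \<in> forests (n - (leaves t - 1))"
    using ts eq by (auto simp: forests_def trees_def)
  then show "ts \<in> (\<Union>k\<le>n. \<Union>t\<in>trees k. (#) t ` forests (n - k))"
    using eq by blast
qed (auto simp: forests_def trees_def)

text \<open>A root vertex would carry at least two subtrees, each with at least one leaf.\<close>

lemma trees_0: "trees 0 = {Leaf}"
proof -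
  have "\<psi> = Leaf" if \<psi>: "admissible \<psi>" "leaves \<psi> = 1" for \<psi>
  proof (cases \<psi>)
    case (Node ts)
    then obtain t u us where "ts = t # u # us"
      using \<psi> by (cases ts rule: remdups_adj.cases) auto
    then show ?thesis
      using \<psi> Node leaves_pos[of t] leaves_pos[of u] by auto
  qed
  then show ?thesis
    by (auto simp: trees_def)
qed

text \<open>The first subtree of the root is separated from its siblings. These keep
  \<open>Suc n - k > 0\<close> leaves, so they form a nonempty list, which is the arity condition at
  the root. Only degrees at most \<open>n\<close> occur on the right, so together with
  \<open>forests_Suc\<close> this is a terminating recursion.\<close>

lemma trees_Suc:
  "trees (Suc n) = (\<Union>k\<le>n. \<Union>t\<in>trees k. (\<lambda>ts. Node (t # ts)) ` forests (Suc n - k))"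
proof (intro equalityI subsetI)
  fix \<psi> assume \<psi>: "\<psi> \<in> trees (Suc n)"
  then obtain ts where Node: "\<psi> = Node ts"
    by (cases \<psi>) (auto simp: trees_def)
  then obtain t us where eq: "ts = t # us" and us: "us \<noteq> []"
    using \<psi> by (cases ts rule: remdups_adj.cases) (auto simp: trees_def)
  have "0 < leaves t" "0 < sum_list (map leaves us)"
    using \<psi> Node eq leaves_pos sum_list_leaves_pos[OF _ us] by (auto simp: trees_def)
  then have "t \<in> trees (leaves t - 1)" "leaves t - 1 \<le> n"
      "us \<in> forests (Suc n - (leaves t - 1))"
    using \<psi> Node eq by (auto simp: forests_def trees_def)
  then show "\<psi> \<in> (\<Union>k\<le>n. \<Union>t\<in>trees k. (\<lambda>ts. Node (t # ts)) ` forests (Suc n - k))"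
    using Node eq by blast
next
  fix \<psi> assume "\<psi> \<in> (\<Union>k\<le>n. \<Union>t\<in>trees k. (\<lambda>ts. Node (t # ts)) ` forests (Suc n - k))"
  then obtain k t ts where *: "k \<le> n" "t \<in> trees k" "ts \<in> forests (Suc n - k)"
      "\<psi> = Node (t # ts)"
    by blast
  then have "ts \<noteq> []"
    by (auto simp: forests_def)
  with * show "\<psi> \<in> trees (Suc n)"
    by (cases ts) (auto simp: forests_def trees_def)
qed

lemma trees_3:
  "trees 3 =
     {Node [Leaf, Node [Leaf, cherry]], Node [Leaf, Node [cherry, Leaf]], Node [cherry, cherry],
      Node [Node [Leaf, cherry], Leaf], Node [Node [cherry, Leaf], Leaf],
      Node [Leaf, Node [Leaf, Leaf, Leaf]], Node [Leaf, Leaf, cherry], Node [Leaf, cherry, Leaf],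
      Node [cherry, Leaf, Leaf], Node [Node [Leaf, Leaf, Leaf], Leaf],
      Node [Leaf, Leaf, Leaf, Leaf]}"
  by (auto simp: numeral_eq_Suc trees_Suc trees_0 forests_Suc forests_0 atMost_Suc)

section \<open>Coefficients of products of polynomials in \<open>t\<close>\<close>

text \<open>The consequence of bilinearity behind the coefficient formulas: products with a
  vanishing coefficient vanish, so the degree bounds in \<open>extend_op\<close> do not affect the
  result.\<close>

definition zero_preserving :: "('a::zero \<Rightarrow> 'a \<Rightarrow> 'a) \<Rightarrow> bool" where
  "zero_preserving f \<longleftrightarrow> (\<forall>x. f x 0 = 0 \<and> f 0 x = 0)"

text \<open>The Cauchy product formula: vanishing beyond \<open>a\<close> and \<open>b\<close> lets
  the ranges bounded by degrees be replaced by the pairs of indices with sum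
  \<open>n\<close>.\<close>

lemma coeff_sum_monom:
  fixes g :: "nat \<Rightarrow> nat \<Rightarrow> 'a::ab_group_add"
  assumes "\<And>i k. a < i \<Longrightarrow> g i k = 0" "\<And>i k. b < k \<Longrightarrow> g i k = 0"
  shows "coeff (\<Sum>i\<le>a. \<Sum>k\<le>b. monom (g i k) (i + k)) n = (\<Sum>i\<le>n. g i (n - i))"
proof -
  have "coeff (\<Sum>i\<le>a. \<Sum>k\<le>b. monom (g i k) (i + k)) n =
      (\<Sum>i\<le>a. \<Sum>k\<le>b. if i + k = n then g i k else 0)"
    by (simp add: coeff_sum)
  also have "\<dots> = (\<Sum>i\<le>a. if i \<le> n then g i (n - i) else 0)"
  proof (rule sum.cong)
    fix i
    \<comment> \<open>At most \<open>k = n - i\<close> contributes; the inner test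
      \<open>i \<le> n\<close> guards against truncated subtraction.\<close>
    have "(\<Sum>k\<le>b. if i + k = n then g i k else 0) =
        (\<Sum>k\<le>b. if k = n - i then (if i \<le> n then g i k else 0) else 0)"
      by (rule sum.cong) auto
    then show "(\<Sum>k\<le>b. if i + k = n then g i k else 0) = (if i \<le> n then g i (n - i) else 0)"
      using assms(2) by (simp add: sum.delta)
  qed simp
  also have "\<dots> = (\<Sum>i\<in>{..a} \<inter> {..n}. g i (n - i))"
    using sum.inter_restrict[of "{..a}" "\<lambda>i. g i (n - i)" "{..n}"] by simp
  also have "\<dots> = (\<Sum>i\<le>n. g i (n - i))"
    using assms(1) leI by (intro sum.mono_neutral_left) blast+
  finally show ?thesis .
qed

text \<open>A constant polynomial has degree 0, so the triple sum collapses to a double one. In the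
  identities at constants \<open>x\<close>, \<open>y\<close>, \<open>z\<close> every product has a
  constant factor, hence this case and its mirror image suffice.\<close>

lemma coeff_extend_op_const_left:
  assumes "\<And>i. zero_preserving (coeff F i)"
  shows "coeff (extend_op F [:x:] q) n = (\<Sum>i\<le>n. coeff F i x (coeff q (n - i)))"
  using coeff_sum_monom[of "degree F" "\<lambda>i k. coeff F i x (coeff q k)" "degree q" n] assms
  by (simp add: extend_op_def coeff_eq_0 zero_preserving_def)

lemma coeff_extend_op_const_right:
  assumes "\<And>i. zero_preserving (coeff F i)"
  shows "coeff (extend_op F p [:x:]) n = (\<Sum>i\<le>n. coeff F i (coeff p (n - i)) x)"
  using coeff_sum_monom[of "degree F" "\<lambda>i k. coeff F i (coeff p k) x" "degree p" n] assms
  by (simp add: extend_op_def coeff_eq_0 zero_preserving_def)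

lemma coeff_extend_op_consts:
  assumes "\<And>i. zero_preserving (coeff F i)"
  shows "coeff (extend_op F [:x:] [:y:]) n = coeff F n x y"
proof -
  have "coeff (extend_op F [:x:] [:y:]) n = (\<Sum>i\<le>n. if i = n then coeff F i x y else 0)"
    unfolding coeff_extend_op_const_left[OF assms]
    by (rule sum.cong)
      (use assms in \<open>auto simp: zero_preserving_def coeff_pCons split: nat.splits\<close>)
  then show ?thesis
    by simp
qed

section \<open>The three components of a 2-cochain\<close>

lemma linear_imp_zero: "Vector_Spaces.linear s s f \<Longrightarrow> f 0 = 0"
  using module_hom.zero by (metis linear_iff_module_hom)

lemma cochain_zero:
  assumes "f \<in> cochains scale 2"
  shows "f \<psi> [x, 0] = 0" "f \<psi> [0, x] = 0"
proof -
  have "multilinear_on scale 2 (f \<psi>)" if "\<psi> \<in> trees 2"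
    using assms that by (auto simp: cochains_def)
  \<comment> \<open>Updating \<open>[x, x]\<close> at either position leaves \<open>x\<close> in the
    other slot, so one list serves both arguments.\<close>
  then have "Vector_Spaces.linear scale scale (\<lambda>x'. f \<psi> ([x, x][0 := x']))"
      "Vector_Spaces.linear scale scale (\<lambda>x'. f \<psi> ([x, x][1 := x']))" if "\<psi> \<in> trees 2"
    using that unfolding multilinear_on_def
    by (metis length_Cons list.size(3) numeral_2_eq_2 zero_less_Suc lessI One_nat_def)+
  from this[THEN linear_imp_zero] show "f \<psi> [x, 0] = 0" "f \<psi> [0, x] = 0"
    using assms by (cases "\<psi> \<in> trees 2"; simp add: cochains_def)+
qed

text \<open>This is the condition under which \<open>map_poly\<close> acts coefficientwise.\<close>

lemma component_zero: "\<alpha> \<in> {lam, rho, mu} \<Longrightarrow> \<alpha> 0 = 0"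
  by (auto simp: lam_def rho_def mu_def fun_eq_iff)

lemma zero_preserving_component:
  "f \<in> cochains scale 2 \<Longrightarrow> \<alpha> \<in> {lam, rho, mu} \<Longrightarrow> zero_preserving (\<alpha> f)"
  by (auto simp: zero_preserving_def lam_def rho_def mu_def cochain_zero)

section \<open>Deformation equations\<close>

text \<open>All eleven identities have the shape \<alpha>(\<beta>(x,y),z) =
  \<gamma>(x,\<epsilon>(y,z)), so a single statement with four component selectors covers
  them.\<close>

lemma cong_associativity_iff:
  assumes ops: "\<alpha> \<in> {lam, rho, mu}" "\<beta> \<in> {lam, rho, mu}" "\<gamma> \<in> {lam, rho, mu}"
      "\<epsilon> \<in> {lam, rho, mu}"
    and coch: "\<And>i. coeff \<Theta> i \<in> cochains scale 2"
  shows "cong_mod_t_power m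
      (extend_op (map_poly \<alpha> \<Theta>) (extend_op (map_poly \<beta> \<Theta>) [:x:] [:y:]) [:z:])
      (extend_op (map_poly \<gamma> \<Theta>) [:x:] (extend_op (map_poly \<epsilon> \<Theta>) [:y:] [:z:])) \<longleftrightarrow>
    (\<forall>n<m. (\<Sum>i\<le>n. \<alpha> (coeff \<Theta> i) (\<beta> (coeff \<Theta> (n - i)) x y) z) =
            (\<Sum>i\<le>n. \<gamma> (coeff \<Theta> i) x (\<epsilon> (coeff \<Theta> (n - i)) y z)))"
proof -
  have zp: "zero_preserving (coeff (map_poly \<pi> \<Theta>) i)" if "\<pi> \<in> {lam, rho, mu}" for \<pi> i
    using zero_preserving_component[OF coch that] component_zero[OF that]
    by (simp add: coeff_map_poly)
  show ?thesis
    unfolding cong_mod_t_power_def coeff_extend_op_const_right[OF zp[OF ops(1)]]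
      coeff_extend_op_const_left[OF zp[OF ops(3)]] coeff_extend_op_consts[OF zp[OF ops(2)]]
      coeff_extend_op_consts[OF zp[OF ops(4)]]
    by (simp add: coeff_map_poly ops[THEN component_zero])
qed

text \<open>In degree \<open>N + 1\<close> the inner summands on both sides form the bracket, and
  the end summands pair \<open>\<theta>\<close> with the constant term of \<open>\<Theta>\<close>.
  Moved to the right, the latter appear in the order of the cofaces 0 to 3.\<close>

lemma cong_associativity_extend:
  fixes \<Theta> :: "'a::ab_group_add cochain poly"
  assumes ops: "\<alpha> \<in> {lam, rho, mu}" "\<beta> \<in> {lam, rho, mu}" "\<gamma> \<in> {lam, rho, mu}"
      "\<epsilon> \<in> {lam, rho, mu}"
    and coch: "\<And>i. coeff \<Theta> i \<in> cochains scale 2" "\<theta> \<in> cochains scale 2"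
      "\<And>i. coeff (\<Theta> + monom \<theta> (N + 1)) i \<in> cochains scale 2"
    and deg: "degree \<Theta> \<le> N"
    and cong: "cong_mod_t_power (N + 1)
      (extend_op (map_poly \<alpha> \<Theta>) (extend_op (map_poly \<beta> \<Theta>) [:x:] [:y:]) [:z:])
      (extend_op (map_poly \<gamma> \<Theta>) [:x:] (extend_op (map_poly \<epsilon> \<Theta>) [:y:] [:z:]))"
    and \<Theta>': "\<Theta>' = \<Theta> + monom \<theta> (N + 1)"
  shows "cong_mod_t_power (N + 1 + 1)
      (extend_op (map_poly \<alpha> \<Theta>') (extend_op (map_poly \<beta> \<Theta>') [:x:] [:y:]) [:z:])
      (extend_op (map_poly \<gamma> \<Theta>') [:x:] (extend_op (map_poly \<epsilon> \<Theta>') [:y:] [:z:])) \<longleftrightarrow>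
    obstruction_bracket N \<Theta> \<alpha> \<beta> \<gamma> \<epsilon> x y z =
      \<gamma> (coeff \<Theta> 0) x (\<epsilon> \<theta> y z) - \<alpha> \<theta> (\<beta> (coeff \<Theta> 0) x y) z
      + \<gamma> \<theta> x (\<epsilon> (coeff \<Theta> 0) y z) - \<alpha> (coeff \<Theta> 0) (\<beta> \<theta> x y) z"
proof -
  have low: "coeff \<Theta>' i = coeff \<Theta> i" if "i \<le> N" for i
    using that by (simp add: \<Theta>')
  have low': "coeff \<Theta>' (Suc N - i) = coeff \<Theta> (Suc N - i)" if "Suc 0 \<le> i" for i
    using that by (intro low) linarith
  \<comment> \<open>The degree bound makes the coefficient of \<open>\<Theta>\<close> at
    \<open>Suc N\<close> vanish, so only the added monomial contributes.\<close>
  have top: "coeff \<Theta>' (Suc N) = \<theta>"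
    using deg by (simp add: \<Theta>' coeff_eq_0)
  have split: "(\<Sum>i\<le>Suc N. h i) = h 0 + h (Suc N) + (\<Sum>i=1..N. h i)" for h :: "nat \<Rightarrow> 'a"
    by (simp add: atMost_atLeast0 sum.atLeast_Suc_atMost[of 0])
  let ?l = "\<lambda>\<Theta> n. \<Sum>i\<le>n. \<alpha> (coeff \<Theta> i) (\<beta> (coeff \<Theta> (n - i)) x y) z"
  let ?r = "\<lambda>\<Theta> n. \<Sum>i\<le>n. \<gamma> (coeff \<Theta> i) x (\<epsilon> (coeff \<Theta> (n - i)) y z)"
  have lower: "?l \<Theta>' n = ?r \<Theta>' n" if "n < N + 1" for n
    using cong that unfolding cong_associativity_iff[OF ops coch(1)] by (simp add: low)
  have "(\<Sum>i=1..N. \<alpha> (coeff \<Theta>' i) (\<beta> (coeff \<Theta>' (Suc N - i)) x y) z) =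
        (\<Sum>i=1..N. \<alpha> (coeff \<Theta> i) (\<beta> (coeff \<Theta> (Suc N - i)) x y) z)"
      "(\<Sum>i=1..N. \<gamma> (coeff \<Theta>' i) x (\<epsilon> (coeff \<Theta>' (Suc N - i)) y z)) =
        (\<Sum>i=1..N. \<gamma> (coeff \<Theta> i) x (\<epsilon> (coeff \<Theta> (Suc N - i)) y z))"
    by (intro sum.cong; simp add: low low')+
  then have "?l \<Theta>' (Suc N) - ?r \<Theta>' (Suc N) =
    obstruction_bracket N \<Theta> \<alpha> \<beta> \<gamma> \<epsilon> x y z
      - (\<gamma> (coeff \<Theta> 0) x (\<epsilon> \<theta> y z) - \<alpha> \<theta> (\<beta> (coeff \<Theta> 0) x y) z
      + \<gamma> \<theta> x (\<epsilon> (coeff \<Theta> 0) y z) - \<alpha> (coeff \<Theta> 0) (\<beta> \<theta> x y) z)"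
    by (simp add: split low top obstruction_bracket_def sum_subtractf algebra_simps del: sum.atMost_Suc)
  then have "?l \<Theta>' (Suc N) = ?r \<Theta>' (Suc N) \<longleftrightarrow>
    obstruction_bracket N \<Theta> \<alpha> \<beta> \<gamma> \<epsilon> x y z =
      \<gamma> (coeff \<Theta> 0) x (\<epsilon> \<theta> y z) - \<alpha> \<theta> (\<beta> (coeff \<Theta> 0) x y) z
      + \<gamma> \<theta> x (\<epsilon> (coeff \<Theta> 0) y z) - \<alpha> (coeff \<Theta> 0) (\<beta> \<theta> x y) z"
    by (rule diff_eq_diff_eq)
  moreover have "(\<forall>n<N + 1 + 1. ?l \<Theta>' n = ?r \<Theta>' n) \<longleftrightarrow> ?l \<Theta>' (Suc N) = ?r \<Theta>' (Suc N)"
    using lower by (auto simp only: less_Suc_eq Suc_eq_plus1[symmetric])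
  ultimately show ?thesis
    using cong_associativity_iff[OF ops, of \<Theta>' scale] coch(3) \<Theta>' by simp
qed

section \<open>Comparison of 3-cochains on the trees of degree 3\<close>

lemma cochain_3_eq_iff:
  assumes "\<And>\<psi> as. \<not> (\<psi> \<in> trees 3 \<and> length as = 3) \<Longrightarrow> f \<psi> as = 0"
    and "\<And>\<psi> as. \<not> (\<psi> \<in> trees 3 \<and> length as = 3) \<Longrightarrow> g \<psi> as = 0"
  shows "f = g \<longleftrightarrow> (\<forall>x y z. \<forall>\<psi> \<in> trees 3. f \<psi> [x, y, z] = g \<psi> [x, y, z])"
proof
  assume *: "\<forall>x y z. \<forall>\<psi> \<in> trees 3. f \<psi> [x, y, z] = g \<psi> [x, y, z]"
  show "f = g"
  proof (intro ext)
    fix \<psi> as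
    show "f \<psi> as = g \<psi> as"
    proof (cases "\<psi> \<in> trees 3 \<and> length as = 3")
      case True
      then obtain x y z where "as = [x, y, z]"
        by (auto simp: numeral_eq_Suc length_Suc_conv)
      with True * show ?thesis
        by simp
    next
      case False
      then show ?thesis
        by (metis assms)
    qed
  qed
qed simp

text \<open>The branches of \<open>obstruction\<close> list exactly the trees in
  \<open>trees_3\<close>, so any other tree falls through to the default 0.
  \<open>coboundary\<close> has the same default, as \<open>cochain_3_eq_iff\<close>
  demands.\<close>

lemma obstruction_eq_0:
  fixes as :: "'a::ab_group_add list"
  assumes "\<not> (\<psi> \<in> trees 3 \<and> length as = 3)"
  shows "obstruction N \<Theta> \<psi> as = 0"
proof (cases "length as = 3")
  case True
  then obtain x y z where as: "as = [x, y, z]"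
    by (auto simp: numeral_eq_Suc length_Suc_conv)
  have "\<psi> \<notin> trees 3"
    using assms True by blast
  then show ?thesis
    unfolding trees_3 insert_iff de_Morgan_disj
    by (simp only: as obstruction_def list.case Let_def if_False)
next
  case False
  then have "(case as of [x, y, z] \<Rightarrow> g x y z | _ \<Rightarrow> 0) = 0" for g :: "'a \<Rightarrow> 'a \<Rightarrow> 'a \<Rightarrow> 'a"
    by (auto split: list.split)
  then show ?thesis
    unfolding obstruction_def .
qed

section \<open>The coboundary of a 2-cochain, tree by tree\<close>

lemma coboundary_2:
  assumes "vector_space scale" "\<psi> \<in> trees 3"
  shows "coboundary scale L R M 2 \<theta> \<psi> [x, y, z] =
      interp L R M (circ 0 \<psi>) x (\<theta> (delete_leaf 0 \<psi>) [y, z])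
      - \<theta> (delete_leaf 1 \<psi>) [interp L R M (circ 1 \<psi>) x y, z]
      + \<theta> (delete_leaf 2 \<psi>) [x, interp L R M (circ 2 \<psi>) y z]
      - interp L R M (circ 3 \<psi>) (\<theta> (delete_leaf 3 \<psi>) [x, y]) z"
proof -
  interpret vector_space scale by fact
  have range: "{0..3} = {0, 1, 2, 3 :: nat}"
    by auto
  show ?thesis
    using assms(2) by (simp add: coboundary_def coface_def range Let_def)
qed

text \<open>A uniform pattern: at the tree with bracket [\<alpha>\<beta>;\<gamma>\<epsilon>],
  deleting leaves 0, 1, 2, 3 gives the trees of \<epsilon>, \<alpha>, \<gamma>, \<beta>, while
  \<open>circ\<close> at 0, 1, 2, 3 gives the operations of \<gamma>, \<beta>, \<epsilon>, \<alpha>.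
  These are the four terms in \<open>cong_associativity_extend\<close>.\<close>

lemma coboundary_2_trees:
  assumes "vector_space scale"
  shows
    "coboundary scale L R M 2 \<theta> (Node [Leaf, Node [Leaf, cherry]]) [x, y, z] =
       L x (lam \<theta> y z) - lam \<theta> (L x y) z + lam \<theta> x (L y z) - L (lam \<theta> x y) z"
    "coboundary scale L R M 2 \<theta> (Node [Leaf, Node [cherry, Leaf]]) [x, y, z] =
       L x (rho \<theta> y z) - lam \<theta> (L x y) z + lam \<theta> x (R y z) - L (lam \<theta> x y) z"
    "coboundary scale L R M 2 \<theta> (Node [cherry, cherry]) [x, y, z] =
       R x (lam \<theta> y z) - lam \<theta> (R x y) z + rho \<theta> x (L y z) - L (rho \<theta> x y) z"
    "coboundary scale L R M 2 \<theta> (Node [Node [Leaf, cherry], Leaf]) [x, y, z] =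
       R x (rho \<theta> y z) - rho \<theta> (L x y) z + rho \<theta> x (R y z) - R (lam \<theta> x y) z"
    "coboundary scale L R M 2 \<theta> (Node [Node [cherry, Leaf], Leaf]) [x, y, z] =
       R x (rho \<theta> y z) - rho \<theta> (R x y) z + rho \<theta> x (R y z) - R (rho \<theta> x y) z"
    "coboundary scale L R M 2 \<theta> (Node [Leaf, Node [Leaf, Leaf, Leaf]]) [x, y, z] =
       L x (mu \<theta> y z) - lam \<theta> (L x y) z + lam \<theta> x (M y z) - L (lam \<theta> x y) z"
    "coboundary scale L R M 2 \<theta> (Node [Leaf, Leaf, cherry]) [x, y, z] =
       M x (lam \<theta> y z) - lam \<theta> (M x y) z + mu \<theta> x (L y z) - L (mu \<theta> x y) z"
    "coboundary scale L R M 2 \<theta> (Node [Leaf, cherry, Leaf]) [x, y, z] =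
       M x (rho \<theta> y z) - mu \<theta> (L x y) z + mu \<theta> x (R y z) - M (lam \<theta> x y) z"
    "coboundary scale L R M 2 \<theta> (Node [cherry, Leaf, Leaf]) [x, y, z] =
       R x (mu \<theta> y z) - mu \<theta> (R x y) z + rho \<theta> x (M y z) - M (rho \<theta> x y) z"
    "coboundary scale L R M 2 \<theta> (Node [Node [Leaf, Leaf, Leaf], Leaf]) [x, y, z] =
       R x (rho \<theta> y z) - rho \<theta> (M x y) z + rho \<theta> x (R y z) - R (mu \<theta> x y) z"
    "coboundary scale L R M 2 \<theta> (Node [Leaf, Leaf, Leaf, Leaf]) [x, y, z] =
       M x (mu \<theta> y z) - mu \<theta> (M x y) z + mu \<theta> x (M y z) - M (mu \<theta> x y) z"
  by (subst coboundary_2[OF assms], simp add: trees_3,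
      simp add: tree_degree_def lam_def rho_def mu_def)+

theorem theorem4p11:
  fixes scale :: "'k::field \<Rightarrow> 'a::ab_group_add \<Rightarrow> 'a"
    and L R M :: "'a \<Rightarrow> 'a \<Rightarrow> 'a"
    and \<Theta> :: "'a cochain poly"
    and \<theta> :: "'a cochain"
    and N :: nat
  assumes "triassociative_algebra scale L R M"
    and "deformation scale L R M N \<Theta>"
    and "\<theta> \<in> cochains scale 2"
  shows "deformation scale L R M (N + 1) (\<Theta> + monom \<theta> (N + 1)) \<longleftrightarrow>
           obstruction N \<Theta> = coboundary scale L R M 2 \<theta>"
proof -
  interpret triassociative_algebra scale L R M by fact
  define \<Theta>' where "\<Theta>' = \<Theta> + monom \<theta> (N + 1)"
  have deg: "degree \<Theta> \<le> N"
    and coeffs: "\<And>i. i \<le> N \<Longrightarrow> coeff \<Theta> i \<in> cochains scale 2"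
    and zeroth: "lam (coeff \<Theta> 0) = L" "rho (coeff \<Theta> 0) = R" "mu (coeff \<Theta> 0) = M"
    and ids: "\<And>x y z. trias_identities (cong_mod_t_power (N + 1))
        (extend_op (map_poly lam \<Theta>)) (extend_op (map_poly rho \<Theta>)) (extend_op (map_poly mu \<Theta>))
        [:x:] [:y:] [:z:]"
    using assms(2) by (auto simp: deformation_def)
  interpret endo: vector_space_pair scale scale ..
  have zero: "0 \<in> cochains scale 2"
    by (simp add: cochains_def multilinear_on_def endo.linear_zero)
  \<comment> \<open>A deformation constrains only the coefficients up to \<open>N\<close>; the later
    ones are 0, which is a cochain too.\<close>
  have coch: "coeff \<Theta> i \<in> cochains scale 2" for i
    using coeffs[of i] zero deg by (cases "i \<le> N") (simp_all add: coeff_eq_0)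
  have coch': "coeff (\<Theta> + monom \<theta> (N + 1)) i \<in> cochains scale 2" for i
    using coch[of i] assms(3) deg by (cases "i = N + 1") (simp_all add: coeff_eq_0)
  have "degree \<Theta>' \<le> N + 1"
    unfolding \<Theta>'_def using deg degree_monom_le[of \<theta> "N + 1"] by (intro degree_add_le) auto
  moreover have "coeff \<Theta>' 0 = coeff \<Theta> 0"
    by (simp add: \<Theta>'_def)
  \<comment> \<open>The other clauses hold outright: adding a term of degree
    \<open>N + 1 > 0\<close> respects the degree bound, the cochain condition and the constant
    term.\<close>
  ultimately have "deformation scale L R M (N + 1) \<Theta>' \<longleftrightarrow>
      (\<forall>x y z. trias_identities (cong_mod_t_power (N + 1 + 1))
        (extend_op (map_poly lam \<Theta>')) (extend_op (map_poly rho \<Theta>')) (extend_op (map_poly mu \<Theta>'))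
        [:x:] [:y:] [:z:])"
    using coch' zeroth by (simp add: deformation_def \<Theta>'_def)
  also have "\<dots> \<longleftrightarrow> (\<forall>x y z. \<forall>\<psi> \<in> trees 3.
      obstruction N \<Theta> \<psi> [x, y, z] = coboundary scale L R M 2 \<theta> \<psi> [x, y, z])"
  proof (intro arg_cong[where f = All] ext)
    fix x y z
    note extend = cong_associativity_extend[OF _ _ _ _ coch assms(3) coch' deg _ \<Theta>'_def]
    \<comment> \<open>The eleven conjuncts are matched one by one; \<open>ids\<close> supplies each
      congruence modulo the lower power of \<open>t\<close>.\<close>
    have "trias_identities (cong_mod_t_power (N + 1 + 1))
        (extend_op (map_poly lam \<Theta>')) (extend_op (map_poly rho \<Theta>')) (extend_op (map_poly mu \<Theta>'))
        [:x:] [:y:] [:z:] \<longleftrightarrow>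
      (let eq = (\<lambda>\<alpha> \<beta> \<gamma> \<epsilon>. obstruction_bracket N \<Theta> \<alpha> \<beta> \<gamma> \<epsilon> x y z =
         \<gamma> (coeff \<Theta> 0) x (\<epsilon> \<theta> y z) - \<alpha> \<theta> (\<beta> (coeff \<Theta> 0) x y) z
         + \<gamma> \<theta> x (\<epsilon> (coeff \<Theta> 0) y z) - \<alpha> (coeff \<Theta> 0) (\<beta> \<theta> x y) z)
       in eq lam lam lam lam \<and> eq lam lam lam rho \<and> eq lam rho rho lam \<and> eq rho lam rho rho \<and>
          eq rho rho rho rho \<and> eq lam lam lam mu \<and> eq lam mu mu lam \<and> eq mu lam mu rho \<and>
          eq mu rho rho mu \<and> eq rho mu rho rho \<and> eq mu mu mu mu)"
      unfolding trias_identities_def Let_def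
      using ids[of x y z, unfolded trias_identities_def]
      by (intro arg_cong2[where f = "(\<and>)"] extend) simp_all
    \<comment> \<open>With the constant terms replaced by \<open>L\<close>, \<open>R\<close>,
      \<open>M\<close>, each equation is literally the one at its tree, because
      \<open>trees_3\<close> lists the trees in the order of the identities.\<close>
    also have "\<dots> \<longleftrightarrow> (\<forall>\<psi> \<in> trees 3.
        obstruction N \<Theta> \<psi> [x, y, z] = coboundary scale L R M 2 \<theta> \<psi> [x, y, z])"
      unfolding trees_3 ball_simps coboundary_2_trees[OF vector_space_axioms]
      by (simp only: zeroth obstruction_def list.case Let_def ptree.inject ptree.distinct list.inject
          list.distinct if_True if_False simp_thms)
    finally show "trias_identities (cong_mod_t_power (N + 1 + 1))
        (extend_op (map_poly lam \<Theta>')) (extend_op (map_poly rho \<Theta>')) (extend_op (map_poly mu \<Theta>'))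
        [:x:] [:y:] [:z:] =
      (\<forall>\<psi> \<in> trees 3.
        obstruction N \<Theta> \<psi> [x, y, z] = coboundary scale L R M 2 \<theta> \<psi> [x, y, z])" .
  qed
  also have "\<dots> \<longleftrightarrow> obstruction N \<Theta> = coboundary scale L R M 2 \<theta>"
    by (rule cochain_3_eq_iff[symmetric]) (auto simp: obstruction_eq_0 coboundary_def)
  finally show ?thesis
    unfolding \<Theta>'_def .
qed

end
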